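(* Let $w$ be the weight system of height $1$ on the lecture hall graph defined by $w(0;i,j)=q^{-i-j-1}$ for $0\le j\le i$ (and $w(t;i,j)=0$ for $t\ge1$). Then for all $n\ge k\ge0$, \[ h^w_{n,k}=\sigma_{n,k}, \] where $\sigma_{n,k}$ are the mixed moments of the Stieltjes--Wigert polynomials.
   Context: Lecture hall graph. For integers $t\ge0$, $0\le j\le i$ put $v^t_{i,j}=(i,\,t+\frac{j}{i+1})$, and set $v^t_{i,i+1}:=v^{t+1}_{i,0}$. The vertices of the lecture hall graph are all $v^t_{i,j}$; its edges join $v^t_{i,j}$ with $v^t_{i,j+1}$ (vertical edges) and $v^t_{i,j}$ with $v^t_{i+1,j}$, for $t\ge 0$, $0\le j\le i$. An east step is a directed edge $(v^t_{i,j},v^t_{i+1,j})$; a south step is a vertical edge directed downwards, $(v^t_{i,j+1},v^t_{i,j})$. A weight system $w$ assigns a weight $w(t;i,j)$ to each east step $(v^t_{i,j},v^t_{i+1,j})$; its height is the smallest integer $\ell$ with $w(t;i,j)=0$ for all $t\ge\ell$. The weight $w(p)$ of a path is the product of the weights of its east steps. $\mathrm{SE}((k,\infty)\to(n,0))$ is the set of paths $(\dots,v_2,v_1,v_0)$ with $v_0=(n,0)$, $\lim_{m\to\infty}v_m=(k,\infty)$, and each $(v_{m+1},v_m)$ a south or east step. Define $h^w_{n,k}=\sum_{p\in \mathrm{SE}((k,\infty)\to(n,0))}w(p)$. Stieltjes--Wigert polynomials. The monic Stieltjes--Wigert polynomials are \[ S_n(x;q)=(-1)^nq^{-n^2}\;{}_1\phi_1\!\left(\begin{matrix}q^{-n}\\0\end{matrix};q,-q^{n+1}x\right),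 \] where ${}_1\phi_1(\alpha;\beta;q,z)=\sum_{k\ge0}\frac{(\alpha;q)_k}{(q;q)_k(\beta;q)_k}(-1)^kq^{\binom k2}z^k$ and $(z;q)_k=\prod_{i=0}^{k-1}(1-zq^i)$. Their mixed moments are defined by $x^n=\sum_{k=0}^n\sigma_{n,k}S_k(x;q)$. Here $q$ is an indeterminate. *)

theory Defs
  imports Complex_Main "HOL-Computational_Algebra.Polynomial"
    "HOL-Computational_Algebra.Fraction_Field" "HOL-Library.Groups_Big_Fun"
begin

section \<open>The lecture hall graph\<close>

text \<open>Vertices are kept as points of the plane, so the identification of
  \<open>lhv t i (i + 1)\<close> with \<open>lhv (t + 1) i 0\<close> holds by computation. The vertices of the
  graph are the points \<open>lhv t i j\<close> with \<open>j \<le> i\<close>.\<close>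

definition lhv :: "nat \<Rightarrow> nat \<Rightarrow> nat \<Rightarrow> nat \<times> real" where
  "lhv t i j = (i, real t + real j / (real i + 1))"

definition is_east_step :: "nat \<times> real \<Rightarrow> nat \<times> real \<Rightarrow> bool" where
  "is_east_step u v \<longleftrightarrow> (\<exists>t i j. j \<le> i \<and> u = lhv t i j \<and> v = lhv t (i + 1) j)"

definition is_south_step :: "nat \<times> real \<Rightarrow> nat \<times> real \<Rightarrow> bool" where
  "is_south_step u v \<longleftrightarrow> (\<exists>t i j. j \<le> i \<and> u = lhv t i (j + 1) \<and> v = lhv t i j)"

text \<open>Paths are infinite and indexed backwards from their endpoint: \<open>p 0 = (n, 0)\<close>, and
  the steps go from \<open>p (m + 1)\<close> to \<open>p m\<close>.\<close>

definition SE_paths :: "nat \<Rightarrow> nat \<Rightarrow> (nat \<Rightarrow> nat \<times> real) set" where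
  "SE_paths k n = {p. p 0 = (n, 0)
     \<and> (\<lambda>m. fst (p m)) \<longlonglongrightarrow> k
     \<and> filterlim (\<lambda>m. snd (p m)) at_top sequentially
     \<and> (\<forall>m. is_south_step (p (m + 1)) (p m) \<or> is_east_step (p (m + 1)) (p m))}"

section \<open>Weights\<close>

text \<open>A weight system is a function \<open>w\<close> whose value \<open>w t i j\<close> is the weight of the east step
  from \<open>lhv t i j\<close> to \<open>lhv t (i + 1) j\<close>; its values at \<open>j > i\<close> are never used.\<close>

definition has_height :: "(nat \<Rightarrow> nat \<Rightarrow> nat \<Rightarrow> 'b::zero) \<Rightarrow> nat \<Rightarrow> bool" where
  "has_height w l \<longleftrightarrow>
     (\<forall>t i j. l \<le> t \<longrightarrow> j \<le> i \<longrightarrow> w t i j = 0) \<and>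
     (\<forall>l'. (\<forall>t i j. l' \<le> t \<longrightarrow> j \<le> i \<longrightarrow> w t i j = 0) \<longrightarrow> l \<le> l')"

text \<open>The triples \<open>(t, i, j)\<close> with \<open>j \<le> i\<close> label the east steps of the graph injectively, and
  a path uses each step at most once, so the east steps of a path form a set (of
  \<open>n - k\<close> elements for a path in \<open>SE_paths k n\<close>).\<close>

definition east_steps :: "(nat \<Rightarrow> nat \<times> real) \<Rightarrow> (nat \<times> nat \<times> nat) set" where
  "east_steps p = {(t, i, j). j \<le> i \<and> (\<exists>m. p (m + 1) = lhv t i j \<and> p m = lhv t (i + 1) j)}"

definition path_weight ::
    "(nat \<Rightarrow> nat \<Rightarrow> nat \<Rightarrow> 'b::comm_semiring_1) \<Rightarrow> (nat \<Rightarrow> nat \<times> real) \<Rightarrow> 'b" where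
  "path_weight w p = (\<Prod>(t, i, j)\<in>east_steps p. w t i j)"

text \<open>\<open>SE_paths k n\<close> is infinite for \<open>k < n\<close>, but if \<open>w\<close> has finite height then only finitely
  many of its paths have nonzero weight; the sum is taken over these.\<close>

definition h_sum :: "(nat \<Rightarrow> nat \<Rightarrow> nat \<Rightarrow> 'b::comm_semiring_1) \<Rightarrow> nat \<Rightarrow> nat \<Rightarrow> 'b" where
  "h_sum w n k = (\<Sum>p\<in>{p \<in> SE_paths k n. path_weight w p \<noteq> 0}. path_weight w p)"

section \<open>Stieltjes--Wigert polynomials\<close>

text \<open>The indeterminate \<open>q\<close>, as an element of the field of rational functions \<open>K(q)\<close>.\<close>

definition q_var :: "'a::field_char_0 poly fract" where
  "q_var = Fract [:0, 1:] 1"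

definition qpoch :: "'b::comm_ring_1 \<Rightarrow> 'b \<Rightarrow> nat \<Rightarrow> 'b" where
  "qpoch z q k = (\<Prod>i<k. 1 - z * q ^ i)"

text \<open>The series \<open>1\<phi>1(a; b; q, z)\<close> for a polynomial argument \<open>z\<close>. \<^const>\<open>Sum_any\<close> sums the
  finitely many nonzero terms of a terminating series, as with \<open>a = q\<^sup>-\<^sup>n\<close>, where
  the terms with index above \<open>n\<close> vanish.\<close>

definition phi11 :: "'b::field \<Rightarrow> 'b \<Rightarrow> 'b \<Rightarrow> 'b poly \<Rightarrow> 'b poly" where
  "phi11 a b q z =
     Sum_any (\<lambda>k. smult (qpoch a q k / (qpoch q q k * qpoch b q k)
                           * (-1) ^ k * q ^ (k choose 2)) (z ^ k))"

definition stieltjes_wigert :: "nat \<Rightarrow> 'a::field_char_0 poly fract poly" where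
  "stieltjes_wigert n =
     smult ((-1) ^ n * q_var powi (- int (n ^ 2)))
       (phi11 (q_var powi (- int n)) 0 q_var [:0, - (q_var ^ (n + 1)):])"

text \<open>The coefficients in the expansion of \<open>x ^ n\<close> in the basis of Stieltjes--Wigert
  polynomials, extended by zero to \<open>k > n\<close>.\<close>

definition sw_mixed_moment :: "nat \<Rightarrow> nat \<Rightarrow> 'a::field_char_0 poly fract" where
  "sw_mixed_moment n =
     (THE s. [:0, 1:] ^ n = (\<Sum>k\<le>n. smult (s k) (stieltjes_wigert k)) \<and> (\<forall>k>n. s k = 0))"

end

(*
  Put u = 1/q. A path of nonzero weight takes all its east steps below height 1. Let F(n,j) be the
  weighted number of paths from (k,infinity) to (n, j/(n+1)). Removing the last step of a path gives
    F(n+1,j) = F(n+1,j+1) + u^(n+j+1) F(n,j)   (j <= n),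
  with F(k,j) = 1, and F(n,n) = 0 for n > k. This q-Pascal recursion is solved by
    F(n,j) = u^(C(n+1,2) - C(k+1,2) + j(n-k)) [n-j, k-j]_u,
  where [n,k]_u denotes the Gaussian binomial coefficient; j = 0 gives h_{n,k}.
  On the other side, the coefficient of x^k in S_n is (-1)^(n+k) u^(n(n-k)) [n,k]_u, and the vanishing
  of the alternating sum of (-1)^i u^C(i,2) [m,i]_u for m > 0 shows that these coefficients form the
  matrix inverse to F(n,0).
*)
theory Submission
  imports Defs
begin

section \<open>Gaussian binomial coefficients\<close>

text \<open>Pascal's rule serves as the definition because it needs no division and so makes sense
  over any commutative ring.\<close>

fun qbinom :: "'b::comm_ring_1 \<Rightarrow> nat \<Rightarrow> nat \<Rightarrow> 'b" where
  "qbinom u n 0 = 1"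
| "qbinom u 0 (Suc k) = 0"
| "qbinom u (Suc n) (Suc k) = u ^ Suc k * qbinom u n (Suc k) + qbinom u n k"

lemma qbinom_eq_0: "n < k \<Longrightarrow> qbinom u n k = 0"
  by (induction u n k rule: qbinom.induct) auto

lemma qbinom_self [simp]: "qbinom u n n = 1"
  by (induction n) (auto simp: qbinom_eq_0)

lemma qpoch_0 [simp]: "qpoch z q 0 = 1"
  and qpoch_Suc: "qpoch z q (Suc n) = qpoch z q n * (1 - z * q ^ n)"
  by (simp_all add: qpoch_def)

lemma qpoch_zero_left [simp]: "qpoch 0 q n = 1"
  by (simp add: qpoch_def)

text \<open>The factorial formula with denominators cleared. Pascal's rule leads from
  \<open>(Suc k, Suc l)\<close> to \<open>(Suc k, l)\<close> and \<open>(k, Suc l)\<close>, hence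
  the nested inductions.\<close>

lemma qbinom_qpoch:
  "qbinom u (k + l) k * (qpoch u u k * qpoch u u l) = qpoch u u (k + l)"
proof (induction k arbitrary: l)
  case (Suc k)
  note outer = Suc.IH
  show ?case
  proof (induction l)
    case (Suc l)
    have "qbinom u (Suc k + Suc l) (Suc k) * (qpoch u u (Suc k) * qpoch u u (Suc l))
      = u ^ Suc k * (1 - u ^ Suc l) * (qbinom u (Suc k + l) (Suc k) * (qpoch u u (Suc k) * qpoch u u l))
        + (1 - u ^ Suc k) * (qbinom u (k + Suc l) k * (qpoch u u k * qpoch u u (Suc l)))"
      by (simp add: qpoch_Suc[of _ _ l] qpoch_Suc[of _ _ k]) (simp add: algebra_simps)
    also have "\<dots> = u ^ Suc k * (1 - u ^ Suc l) * qpoch u u (Suc k + l)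
        + (1 - u ^ Suc k) * qpoch u u (k + Suc l)"
      by (simp only: Suc.IH outer)
    \<comment> \<open>Both symbols are (u;u)_(k+l+1), and u^(k+1) (1 - u^(l+1)) + (1 - u^(k+1)) = 1
      - u^(k+l+2).\<close>
    also have "\<dots> = qpoch u u (Suc k + Suc l)"
      by (simp add: qpoch_Suc algebra_simps power_add)
    finally show ?case .
  qed simp
qed simp

text \<open>Pascal's rule makes the alternating sum telescope; partial sums have a closed form
  suited to induction.\<close>

lemma alternating_sum_qbinom_partial:
  "(\<Sum>i\<le>t. (-1) ^ i * u ^ (i choose 2) * qbinom u (Suc m) i)
     = (-1) ^ t * u ^ (Suc t choose 2) * qbinom u m t"
proof (induction t)
  case (Suc t)
  have "Suc (Suc t) choose 2 = Suc t + (Suc t choose 2)"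
    by (simp add: numeral_2_eq_2)
  with Suc show ?case
    by (simp add: power_add algebra_simps)
qed (simp add: numeral_2_eq_2)

lemma alternating_sum_qbinom:
  assumes "m > 0"
  shows "(\<Sum>i\<le>m. (-1) ^ i * u ^ (i choose 2) * qbinom u m i) = 0"
  using assms alternating_sum_qbinom_partial[where t = m and m = "m - 1" and u = u]
  by (simp add: qbinom_eq_0)

section \<open>Closed form when \<open>u\<close> is not a root of unity\<close>

context
  fixes u :: "'b::field"
  assumes u_not_root: "\<And>i. i > 0 \<Longrightarrow> u ^ i \<noteq> 1"
begin

lemma qpoch_nonzero: "qpoch u u n \<noteq> 0"
proof (induction n)
  case (Suc n)
  then show ?case using u_not_root[of "Suc n"] by (simp add: qpoch_Suc)
qed simp

lemma qbinom_closed: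
  "k \<le> n \<Longrightarrow> qbinom u n k = qpoch u u n / (qpoch u u k * qpoch u u (n - k))"
  using qbinom_qpoch[of u k "n - k"] qpoch_nonzero by (simp add: field_simps)

text \<open>The other Pascal rule, read off the closed form. For k = n that form does not cover
  \<open>qbinom u n (Suc k)\<close>, which is zero.\<close>

lemma qbinom_Suc_Suc':
  assumes "k \<le> n"
  shows "qbinom u (Suc n) (Suc k) = qbinom u n (Suc k) + u ^ (n - k) * qbinom u n k"
proof (cases "k = n")
  case True
  then show ?thesis by (simp add: qbinom_eq_0)
next
  case False
  then obtain l where n: "n = k + Suc l"
    using assms by (metis add_Suc_right le_neq_implies_less less_iff_Suc_add)
  have *: "1 - u * u ^ k \<noteq> 0" "1 - u * u ^ l \<noteq> 0"
    using u_not_root[of "Suc k"] u_not_root[of "Suc l"] by simp_all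
  show ?thesis
    using * qpoch_nonzero[of k] qpoch_nonzero[of l]
    by (simp add: qbinom_closed n del: qbinom.simps add_Suc_right)
      (simp add: qpoch_Suc divide_simps power_add, simp add: algebra_simps)
qed

text \<open>Both sides are the Gaussian trinomial coefficient with parts j, k - j, n - k. This takes
  a factor independent of k out of the inversion sum.\<close>

lemma qbinom_mult_qbinom:
  assumes "j \<le> k" "k \<le> n"
  shows "qbinom u n k * qbinom u k j = qbinom u n j * qbinom u (n - j) (k - j)"
  using assms qpoch_nonzero by (simp add: qbinom_closed)

end

section \<open>Mixed moments of the Stieltjes--Wigert polynomials\<close>

lemma q_var_nonzero [simp]: "q_var \<noteq> (0 :: 'a::field_char_0 poly fract)"
  by (simp add: q_var_def Zero_fract_def eq_fract)

lemma q_var_power: "q_var ^ n = Fract ([:0, 1:] ^ n) (1 :: 'a::field_char_0 poly)"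
  by (induction n) (simp_all add: q_var_def One_fract_def mult_fract)

lemma q_var_not_root:
  assumes "n > 0"
  shows "q_var ^ n \<noteq> (1 :: 'a::field_char_0 poly fract)"
proof
  assume "q_var ^ n = (1 :: 'a poly fract)"
  then have "[:0, 1:] ^ n = (1 :: 'a poly)"
    by (simp add: q_var_power One_fract_def eq_fract)
  then have "degree ([:0, 1:] ^ n :: 'a poly) = 0"
    by simp
  with assms show False
    by (simp add: degree_power_eq)
qed

abbreviation q_inv :: "'a::field_char_0 poly fract" where
  "q_inv \<equiv> inverse q_var"

lemma q_inv_not_root: "n > 0 \<Longrightarrow> q_inv ^ n \<noteq> (1 :: 'a::field_char_0 poly fract)"
  by (simp add: power_inverse q_var_not_root)

text \<open>With u = 1/q, factor i of (u^n;q)_k is 1 - u^(n-i), so these are the top k factors of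
  (u;u)_n.\<close>

lemma qpoch_inverse_power:
  fixes q :: "'b::field"
  assumes "q \<noteq> 0" "k \<le> n"
  shows "qpoch (inverse q ^ n) q k * qpoch (inverse q) (inverse q) (n - k)
    = qpoch (inverse q) (inverse q) n"
  using assms(2)
proof (induction k)
  case (Suc k)
  let ?u = "inverse q"
  obtain l where n: "n = Suc k + l"
    using Suc.prems le_Suc_ex by blast
  have "?u ^ n * q ^ k = ?u * ?u ^ l"
    using assms(1) by (simp add: n power_add field_simps)
  moreover have "n - k = Suc l" "n - Suc k = l"
    using n by simp_all
  ultimately show ?case
    using Suc.IH Suc.prems by (simp only: qpoch_Suc) (simp add: mult_ac)
qed simp

text \<open>The factor with index n is 1 - q^(-n) q^n = 0; this terminates the series.\<close>

lemma qpoch_inverse_power_eq_0: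
  fixes q :: "'b::field"
  assumes "q \<noteq> 0" "n < k"
  shows "qpoch (inverse q ^ n) q k = 0"
  using assms by (auto simp: qpoch_def simp flip: power_mult_distrib intro!: bexI[of _ n])

text \<open>Each factor satisfies 1 - q^i = -q^i (1 - q^(-i)); the exponents 1, ..., k add up to
  C(k+1,2).\<close>

lemma qpoch_self_inverse:
  fixes q :: "'b::field"
  assumes "q \<noteq> 0"
  shows "qpoch q q k = (-1) ^ k * q ^ (Suc k choose 2) * qpoch (inverse q) (inverse q) k"
proof (induction k)
  case (Suc k)
  have "Suc (Suc k) choose 2 = Suc k + (Suc k choose 2)"
    by (simp add: numeral_2_eq_2)
  then have C: "q ^ (Suc (Suc k) choose 2) = q * q ^ k * q ^ (Suc k choose 2)"
    by (simp add: power_add)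
  have "1 - q * q ^ k = - (q * q ^ k * (1 - inverse q * inverse q ^ k))"
    using assms by (simp add: field_simps)
  then show ?case
    unfolding qpoch_Suc Suc C by simp
qed (simp add: numeral_2_eq_2)

lemma coeff_linear_power:
  "coeff ([:0, c:] ^ k) m = (if m = k then c ^ k else (0 :: 'b::comm_semiring_1))"
proof -
  have "[:0, c:] ^ k = monom (c ^ k) k"
    by (metis monom_0 monom_Suc monom_power mult_1_left One_nat_def)
  then show ?thesis by simp
qed

text \<open>Passing to base 1/q turns the series coefficient into a Gaussian binomial. For k > n the
  truncation of n - k is harmless, both sides being zero.\<close>

lemma coeff_stieltjes_wigert:
  "coeff (stieltjes_wigert n :: 'a::field_char_0 poly fract poly) k
     = (-1) ^ (n + k) * q_inv ^ (n * (n - k)) * qbinom q_inv n k"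
proof -
  let ?q = "q_var :: 'a poly fract"
  let ?c = "\<lambda>k. qpoch (?q powi - int n) ?q k / (qpoch ?q ?q k * qpoch 0 ?q k)
                           * (-1) ^ k * ?q ^ (k choose 2)"
  have neg: "?q powi - int n = q_inv ^ n"
    by (simp add: power_int_minus power_inverse)
  have z: "?c k = 0" if "n < k" for k
    using qpoch_inverse_power_eq_0[of ?q n k] that by (simp add: neg)
  have "phi11 (?q powi - int n) 0 ?q [:0, - (?q ^ (n + 1)):]
      = (\<Sum>k\<le>n. smult (?c k) ([:0, - (?q ^ (n + 1)):] ^ k))"
    unfolding phi11_def
  proof (rule Sum_any.expand_superset)
    show "{k. smult (?c k) ([:0, - (?q ^ (n + 1)):] ^ k) \<noteq> 0} \<subseteq> {..n}"
      using z by (metis (mono_tags, lifting) atMost_iff leI mem_Collect_eq smult_0_left subsetI)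
  qed simp
  then have c: "coeff (stieltjes_wigert n :: 'a poly fract poly) k =
      (-1) ^ n * ?q powi - int (n ^ 2) *
        (if k \<le> n then ?c k * (- (?q ^ (n + 1))) ^ k else 0)"
    unfolding stieltjes_wigert_def
    by (simp add: coeff_sum coeff_linear_power if_distrib[of "\<lambda>x. _ * x"] cong: if_cong)
  show ?thesis
  proof (cases "k \<le> n")
    case True
    let ?P = "qpoch q_inv (q_inv :: 'a poly fract)"
    obtain l where n: "n = k + l" using True le_Suc_ex by blast
    have nz: "?P i \<noteq> 0" for i
      by (intro qpoch_nonzero q_inv_not_root)
    have 1: "qpoch (q_inv ^ n) ?q k = ?P n / ?P (n - k)"
      using qpoch_inverse_power[of ?q k n] nz True by (simp add: field_simps)
    have 2: "?q ^ (Suc k choose 2) = ?q ^ k * ?q ^ (k choose 2)"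
      by (simp add: numeral_2_eq_2 power_add)
    have 3: "(- (?q ^ (n + 1))) ^ k = (-1) ^ k * ?q ^ (n * k) * ?q ^ k"
      by (subst power_minus) (simp add: power_mult_distrib flip: power_mult)
    have 4: "?q powi - int (n ^ 2) = q_inv ^ (n * (n - k)) / ?q ^ (n * k)"
      unfolding power_int_minus power_int_of_nat
      by (simp add: n power2_eq_square power_add power_inverse divide_inverse algebra_simps)
    have 5: "qbinom q_inv n k * (?P k * ?P (n - k)) = ?P n"
      using qbinom_qpoch[of q_inv k l] by (simp add: n)
    have sign: "(-1) ^ k * (-1) ^ k = (1 :: 'a poly fract)"
      by (simp flip: power_mult_distrib)
    \<comment> \<open>A sign (-1)^k comes from the series, from its argument and from (q;q)_k; two
      of the three cancel. The exponent of q is -n^2 + nk + k + C(k,2) - C(k+1,2) = -n(n-k).\<close>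
    show ?thesis
      unfolding c neg 1 qpoch_self_inverse[OF q_var_nonzero, of k]
        2 3 4
      using True nz[of k] nz[of "n - k"] sign 5
      by (simp add: power_add divide_simps mult.commute)
  qed (simp add: c qbinom_eq_0)
qed

text \<open>Linear independence: S_k is monic of degree k, so the coefficient of x^n isolates
  \<open>d n\<close>, and induction removes that term.\<close>

lemma sum_stieltjes_wigert_eq_0D:
  fixes d :: "nat \<Rightarrow> 'a::field_char_0 poly fract"
  assumes "(\<Sum>k\<le>n. smult (d k) (stieltjes_wigert k)) = 0" "k \<le> n"
  shows "d k = 0"
  using assms
proof (induction n)
  case (Suc n)
  have "coeff (\<Sum>k\<le>Suc n. smult (d k) (stieltjes_wigert k)) (Suc n) = d (Suc n)"
    by (simp add: coeff_sum coeff_stieltjes_wigert qbinom_eq_0 del: qbinom.simps flip: mult_2)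
  with Suc show ?case
    by (auto simp: le_Suc_eq)
qed (auto dest: arg_cong[of _ _ "\<lambda>p. coeff p 0"] simp: coeff_stieltjes_wigert)

text \<open>The closed form F(n,0). The exponent C(n+1,2) - C(k+1,2) is kept as a quotient of powers
  to avoid truncated subtraction.\<close>

definition sw_moment :: "nat \<Rightarrow> nat \<Rightarrow> 'a::field_char_0 poly fract" where
  "sw_moment n k = q_inv ^ (Suc n choose 2) / q_inv ^ (Suc k choose 2) * qbinom q_inv n k"

text \<open>Comparing coefficients of x^j makes this an inversion of triangular matrices: with k = j
  + i the sum over k becomes a multiple of the alternating sum of the [n-j, i].\<close>

lemma power_eq_sum_stieltjes_wigert:
  "[:0, 1:] ^ n = (\<Sum>k\<le>n. smult (sw_moment n k :: 'a::field_char_0 poly fract) (stieltjes_wigert k))"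
proof (rule poly_eqI)
  fix j
  let ?u = "q_inv :: 'a poly fract"
  let ?f = "\<lambda>k. sw_moment n k * coeff (stieltjes_wigert k :: 'a poly fract poly) j"
  have "(\<Sum>k\<le>n. ?f k) = (if j = n then 1 else 0)"
  proof (cases "j \<le> n")
    case False
    then show ?thesis by (auto simp: coeff_stieltjes_wigert qbinom_eq_0)
  next
    case True
    have f: "?f (j + i) = ?u ^ (Suc n choose 2) / ?u ^ (Suc j choose 2) * qbinom ?u n j
        * ((-1) ^ i * ?u ^ (i choose 2) * qbinom ?u (n - j) i)" if "i \<le> n - j" for i
    proof -
      \<comment> \<open>The exponent (j+i)i comes from S_(j+i), and C(j+i+1,2) from the denominator
        of the moment; they leave the C(i,2) of the alternating sum.\<close>
      have "(j + i) * i + (Suc j choose 2) = (Suc (j + i) choose 2) + (i choose 2)"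
        by (induction i) (simp_all add: numeral_2_eq_2)
      then have "?u ^ ((j + i) * i) * ?u ^ (Suc j choose 2)
          = ?u ^ (Suc (j + i) choose 2) * ?u ^ (i choose 2)"
        by (metis power_add)
      then have e: "?u ^ ((j + i) * i) / ?u ^ (Suc (j + i) choose 2)
          = ?u ^ (i choose 2) / ?u ^ (Suc j choose 2)"
        by (simp add: frac_eq_eq mult.commute del: power_inverse)
      have s: "(-1) ^ (j + i + j) = ((-1) ^ i :: 'a poly fract)"
        by (simp add: power_add flip: power_mult_distrib)
      have "?f (j + i) = ?u ^ (Suc n choose 2) * (?u ^ ((j + i) * i) / ?u ^ (Suc (j + i) choose 2))
         * (-1) ^ i * (qbinom ?u n (j + i) * qbinom ?u (j + i) j)"
        unfolding sw_moment_def coeff_stieltjes_wigert s by simp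
      also have "qbinom ?u n (j + i) * qbinom ?u (j + i) j = qbinom ?u n j * qbinom ?u (n - j) i"
        by (subst qbinom_mult_qbinom[OF q_inv_not_root]) (use True that in simp_all)
      finally show ?thesis unfolding e by (simp add: mult_ac)
    qed
    have "(\<Sum>k\<le>n. ?f k) = (\<Sum>k\<in>{j..n}. ?f k)"
      by (rule sum.mono_neutral_right) (auto simp: coeff_stieltjes_wigert qbinom_eq_0)
    also have "\<dots> = (\<Sum>i\<le>n - j. ?f (j + i))"
      using True by (intro sum.reindex_bij_witness[of _ "\<lambda>i. j + i" "\<lambda>k. k - j"]) auto
    also have "\<dots> = ?u ^ (Suc n choose 2) / ?u ^ (Suc j choose 2) * qbinom ?u n j
        * (\<Sum>i\<le>n - j. (-1) ^ i * ?u ^ (i choose 2) * qbinom ?u (n - j) i)"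
      unfolding sum_distrib_left by (rule sum.cong) (use f in auto)
    also have "\<dots> = (if j = n then 1 else 0)"
      using True alternating_sum_qbinom[of "n - j" ?u] by (auto simp: numeral_2_eq_2)
    finally show ?thesis .
  qed
  then show "coeff ([:0, 1:] ^ n) j
      = coeff (\<Sum>k\<le>n. smult (sw_moment n k :: 'a poly fract) (stieltjes_wigert k)) j"
    by (simp add: coeff_linear_power coeff_sum)
qed

text \<open>\<open>THE\<close> also requires uniqueness: the difference of two expansions is a
  vanishing combination, and the values beyond n are zero by convention.\<close>

lemma sw_mixed_moment_eq: "sw_mixed_moment n = (sw_moment n :: nat \<Rightarrow> 'a::field_char_0 poly fract)"
  unfolding sw_mixed_moment_def
proof (rule the_equality, goal_cases)
  case 1
  show ?case
    using power_eq_sum_stieltjes_wigert by (auto simp: sw_moment_def qbinom_eq_0)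
next
  case (2 s)
  show ?case
  proof
    fix k
    have "(\<Sum>k\<le>n. smult (s k - sw_moment n k) (stieltjes_wigert k)) = 0"
      using 2 power_eq_sum_stieltjes_wigert[of n, where 'a = 'a]
      by (simp add: smult_diff_left sum_subtractf)
    then show "s k = sw_moment n k"
      using sum_stieltjes_wigert_eq_0D[of "\<lambda>k. s k - sw_moment n k" n k] 2
      by (cases "k \<le> n") (auto simp: sw_moment_def qbinom_eq_0)
  qed
qed

section \<open>Paths in the lecture hall graph\<close>

text \<open>In column i, the height times i + 1 is the integer t (i + 1) + j; for j \<le> i
  Euclidean division recovers t and j.\<close>

lemma lhv_eq_iff:
  assumes "j \<le> i" "j' \<le> i'"
  shows "lhv t i j = lhv t' i' j' \<longleftrightarrow> t = t' \<and> i = i' \<and> j = j'"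
proof
  assume eq: "lhv t i j = lhv t' i' j'"
  then have i: "i' = i" by (simp add: lhv_def)
  with eq have "real t * (real i + 1) + real j = real t' * (real i + 1) + real j'"
    by (simp add: lhv_def field_simps)
  then have "real (t * Suc i + j) = real (t' * Suc i + j')"
    by (simp add: algebra_simps)
  then have N: "t * Suc i + j = t' * Suc i + j'"
    by (simp only: of_nat_eq_iff)
  have "t = (t * Suc i + j) div Suc i" "t' = (t' * Suc i + j') div Suc i"
    using assms i by (simp_all del: mult_Suc_right)
  with N have "t = t'" by simp
  with N i show "t = t' \<and> i = i' \<and> j = j'" by simp
qed simp

lemma lhv_Suc_self: "lhv t i (Suc i) = lhv (Suc t) i 0"
  by (simp add: lhv_def add.commute)

lemma lhv_div_mod: "lhv (N div Suc i) i (N mod Suc i) = (i, real N / (real i + 1))"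
proof -
  have "real N = real (N div Suc i) * (real i + 1) + real (N mod Suc i)"
    by (metis div_mult_mod_eq of_nat_Suc of_nat_add of_nat_mult add.commute)
  then show ?thesis
    by (simp add: lhv_def field_simps)
qed

section \<open>Steps and the predecessors of a vertex\<close>

lemma is_south_step_coords:
  "is_south_step u v \<Longrightarrow> fst u = fst v \<and> snd u = snd v + 1 / (real (fst v) + 1)"
  by (auto simp: is_south_step_def lhv_def add_divide_distrib)

lemma is_east_step_fst: "is_east_step u v \<Longrightarrow> fst v = Suc (fst u)"
  by (auto simp: is_east_step_def lhv_def)

lemma is_east_step_snd_mono: "is_east_step u v \<Longrightarrow> snd v \<le> snd u"
  by (auto simp: is_east_step_def lhv_def intro!: divide_left_mono)

text \<open>For j = i the predecessor is the bottom vertex of the next unit interval.\<close>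

lemma is_south_step_lhv_iff:
  assumes "j \<le> i"
  shows "is_south_step u (lhv t i j) \<longleftrightarrow> u = lhv t i (Suc j)"
  using assms by (auto simp: is_south_step_def lhv_eq_iff)

text \<open>Column i + 1 has one vertex more per unit of height than column i, so its vertex with j
  = i + 1 has no incoming east step.\<close>

lemma is_east_step_lhv_iff:
  assumes "j \<le> Suc i"
  shows "is_east_step u (lhv t (Suc i) j) \<longleftrightarrow> j \<le> i \<and> u = lhv t i j"
  using assms unfolding is_east_step_def
  by (metis Suc_eq_plus1 lhv_eq_iff le_SucI nat.inject)

definition paths_to :: "nat \<Rightarrow> nat \<times> real \<Rightarrow> (nat \<Rightarrow> nat \<times> real) set" where
  "paths_to k v = {p. p 0 = v
     \<and> (\<lambda>m. fst (p m)) \<longlonglongrightarrow> k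
     \<and> filterlim (\<lambda>m. snd (p m)) at_top sequentially
     \<and> (\<forall>m. is_south_step (p (m + 1)) (p m) \<or> is_east_step (p (m + 1)) (p m))}"

lemma SE_paths_eq: "SE_paths k n = paths_to k (lhv 0 n 0)"
  by (simp add: SE_paths_def paths_to_def lhv_def)

section \<open>Columns, heights and east steps along a path\<close>

lemma paths_to_fst_antimono:
  assumes "p \<in> paths_to k v" "m \<le> m'"
  shows "fst (p m') \<le> fst (p m)"
proof -
  have "is_south_step (p (Suc m)) (p m) \<or> is_east_step (p (Suc m)) (p m)" for m
    using assms(1) by (simp add: paths_to_def)
  then have "fst (p (Suc m)) \<le> fst (p m)" for m
    using is_south_step_coords is_east_step_fst by (metis le_Suc_eq order_refl)
  then have "decseq (\<lambda>m. fst (p m))"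
    by (intro decseq_SucI)
  with assms(2) show ?thesis by (simp add: decseq_def)
qed

lemma paths_to_snd_mono:
  assumes "p \<in> paths_to k v" "m \<le> m'"
  shows "snd (p m) \<le> snd (p m')"
proof -
  have "snd (p m) \<le> snd (p (Suc m))" for m
    using assms(1) is_south_step_coords[of "p (Suc m)" "p m"] is_east_step_snd_mono[of "p (Suc m)" "p m"]
    by (force simp: paths_to_def)
  then have "incseq (\<lambda>m. snd (p m))"
    by (intro incseq_SucI)
  with assms(2) show ?thesis by (simp add: incseq_def)
qed

text \<open>Columns are natural numbers, where convergence means being eventually constant.\<close>

lemma paths_to_eventually:
  assumes "p \<in> paths_to k v"
  obtains M where "\<And>m. M \<le> m \<Longrightarrow> fst (p m) = k"
  using assms by (auto simp: paths_to_def tendsto_discrete eventually_sequentially)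

lemma paths_to_fst_ge:
  assumes "p \<in> paths_to k v"
  shows "k \<le> fst (p m)"
proof -
  obtain M where "\<And>m. M \<le> m \<Longrightarrow> fst (p m) = k"
    using paths_to_eventually[OF assms] by blast
  then have "fst (p (max m M)) = k" by simp
  with paths_to_fst_antimono[OF assms, of m "max m M"] show ?thesis by simp
qed

text \<open>Columns do not increase with the index. Hence an east step put in front of a path has a
  label that the path does not contain yet.\<close>

lemma east_steps_fst_less:
  assumes "p \<in> paths_to k v" "(t, i, j) \<in> east_steps p"
  shows "i < fst v"
proof -
  obtain m where "p m = lhv t (Suc i) j"
    using assms(2) by (auto simp: east_steps_def)
  with paths_to_fst_antimono[OF assms(1), of 0 m] assms(1) show ?thesis
    by (simp add: paths_to_def lhv_def)
qed

lemma finite_lhv_label: "finite {(t, i, j). j \<le> i \<and> v = lhv t i j}"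
proof (cases "\<exists>t i j. j \<le> i \<and> v = lhv t i j")
  case True
  then obtain t i j where "j \<le> i" "v = lhv t i j" by blast
  then have "{(t, i, j). j \<le> i \<and> v = lhv t i j} \<subseteq> {(t, i, j)}"
    by (auto simp: lhv_eq_iff)
  then show ?thesis by (rule finite_subset) simp
next
  case False
  then have "{(t, i, j). j \<le> i \<and> v = lhv t i j} = {}" by auto
  then show ?thesis by (simp only: finite.emptyI)
qed

text \<open>No east step occurs once the column is constant. Finiteness matters because a product
  over an infinite set defaults to 1.\<close>

lemma finite_east_steps:
  assumes "p \<in> paths_to k v"
  shows "finite (east_steps p)"
proof -
  obtain M where M: "\<And>m. M \<le> m \<Longrightarrow> fst (p m) = k"
    using paths_to_eventually[OF assms] by blast
  have "m < M" if "p (m + 1) = lhv t i j" "p m = lhv t (i + 1) j" for m t i j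
    using M[of m] M[of "m + 1"] that by (force simp: lhv_def intro: ccontr)
  then have "east_steps p \<subseteq> (\<Union>m<M. {(t, i, j). j \<le> i \<and> p (m + 1) = lhv t i j})"
    unfolding east_steps_def by blast
  then show ?thesis
    by (rule finite_subset) (intro finite_UN_I finite_lessThan finite_lhv_label)
qed

lemma path_weight_nonzero_iff:
  fixes w :: "nat \<Rightarrow> nat \<Rightarrow> nat \<Rightarrow> 'b::idom"
  assumes "p \<in> paths_to k v"
  shows "path_weight w p \<noteq> 0 \<longleftrightarrow> (\<forall>(t, i, j)\<in>east_steps p. w t i j \<noteq> 0)"
  unfolding path_weight_def using finite_east_steps[OF assms]
  by (auto simp: prod_zero_iff)

section \<open>Splitting off the last step\<close>

lemma paths_to_case_nat:
  "case_nat v p \<in> paths_to k v'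
     \<longleftrightarrow> v = v' \<and> (is_south_step (p 0) v \<or> is_east_step (p 0) v) \<and> p \<in> paths_to k (p 0)"
proof -
  have all: "(\<forall>m. P m) \<longleftrightarrow> P 0 \<and> (\<forall>m. P (Suc m))" for P :: "nat \<Rightarrow> bool"
    using not0_implies_Suc by metis
  have "(\<lambda>m. fst (case_nat v p m)) \<longlonglongrightarrow> k \<longleftrightarrow> (\<lambda>m. fst (p m)) \<longlonglongrightarrow> k"
    using filterlim_sequentially_Suc[of "\<lambda>m. fst (case_nat v p m)" "nhds k"] by simp
  moreover have "filterlim (\<lambda>m. snd (case_nat v p m)) at_top sequentially
      \<longleftrightarrow> filterlim (\<lambda>m. snd (p m)) at_top sequentially"
    using filterlim_sequentially_Suc[of "\<lambda>m. snd (case_nat v p m)" at_top] by simp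
  ultimately show ?thesis
    unfolding paths_to_def
    by (subst mem_Collect_eq, subst all) auto
qed

lemma case_nat_shift: "case_nat (p 0) (\<lambda>m. p (Suc m)) = p"
  by (auto split: nat.split)

text \<open>Paths are indexed backwards, so \<open>case_nat v\<close> puts \<open>v\<close> in front
  of the sequence and thereby adds a last step to the path.\<close>

lemma paths_to_eq_step:
  "paths_to k v = (\<Union>u\<in>{u. is_south_step u v \<or> is_east_step u v}. case_nat v ` paths_to k u)"
proof (rule set_eqI, rule iffI)
  fix p assume p: "p \<in> paths_to k v"
  then have v: "p 0 = v" by (simp add: paths_to_def)
  let ?p = "\<lambda>m. p (Suc m)"
  have eq: "p = case_nat v ?p" using case_nat_shift[of p] v by simp
  with p have "case_nat v ?p \<in> paths_to k v" by simp
  then show "p \<in> (\<Union>u\<in>{u. is_south_step u v \<or> is_east_step u v}. case_nat v ` paths_to k u)"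
    unfolding paths_to_case_nat
    by (intro UN_I[of "p (Suc 0)"]) (use eq in auto)
next
  fix p assume "p \<in> (\<Union>u\<in>{u. is_south_step u v \<or> is_east_step u v}. case_nat v ` paths_to k u)"
  then obtain u p' where "is_south_step u v \<or> is_east_step u v" "p' \<in> paths_to k u" "p = case_nat v p'"
    by blast
  then show "p \<in> paths_to k v"
    by (auto simp: paths_to_case_nat) (auto simp: paths_to_def)
qed

lemma east_steps_case_nat:
  "east_steps (case_nat v p)
     = {(t, i, j). j \<le> i \<and> p 0 = lhv t i j \<and> v = lhv t (i + 1) j} \<union> east_steps p"
proof -
  have ex: "(\<exists>m. P m) \<longleftrightarrow> P 0 \<or> (\<exists>m. P (Suc m))" for P :: "nat \<Rightarrow> bool"
    using not0_implies_Suc by metis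
  show ?thesis
    unfolding east_steps_def by (subst ex) auto
qed

lemma path_weight_south:
  assumes "fst (p 0) = fst v"
  shows "path_weight w (case_nat v p) = path_weight w p"
proof -
  have "east_steps (case_nat v p) = east_steps p"
    using assms by (auto simp: east_steps_case_nat lhv_def)
  then show ?thesis by (simp add: path_weight_def)
qed

lemma path_weight_east:
  assumes "p \<in> paths_to k (lhv t i j)" "j \<le> i"
  shows "path_weight w (case_nat (lhv t (Suc i) j) p) = w t i j * path_weight w p"
proof -
  have "p 0 = lhv t i j" using assms by (simp add: paths_to_def)
  then have "east_steps (case_nat (lhv t (Suc i) j) p) = insert (t, i, j) (east_steps p)"
    using assms(2) by (auto simp: east_steps_case_nat lhv_eq_iff)
  moreover have "(t, i, j) \<notin> east_steps p"
    using east_steps_fst_less[OF assms(1)] by (auto simp: lhv_def)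
  ultimately show ?thesis
    using finite_east_steps[OF assms(1)] by (simp add: path_weight_def)
qed

text \<open>The column is bounded by k from both sides, so every step is a south step and the path
  is forced.\<close>

lemma paths_to_column:
  assumes "j \<le> k"
  shows "paths_to k (lhv 0 k j) = {\<lambda>m. (k, real (j + m) / (real k + 1))}"
proof (intro equalityI subsetI)
  fix p assume p: "p \<in> paths_to k (lhv 0 k j)"
  have k: "fst (p m) = k" for m
    using paths_to_fst_ge[OF p, of m] paths_to_fst_antimono[OF p, of 0 m] p
    by (simp add: paths_to_def lhv_def)
  have "p m = (k, real (j + m) / (real k + 1))" for m
  proof (induction m)
    case 0
    then show ?case using p by (simp add: paths_to_def lhv_def)
  next
    case (Suc m)
    have "is_south_step (p (Suc m)) (p m) \<or> is_east_step (p (Suc m)) (p m)"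
      using p by (simp add: paths_to_def)
    then have "is_south_step (p (Suc m)) (p m)"
      using is_east_step_fst[of "p (Suc m)" "p m"] k by auto
    from is_south_step_coords[OF this] Suc k show ?case
      by (simp add: prod_eq_iff field_simps)
  qed
  then show "p \<in> {\<lambda>m. (k, real (j + m) / (real k + 1))}" by auto
next
  fix p :: "nat \<Rightarrow> nat \<times> real"
  assume "p \<in> {\<lambda>m. (k, real (j + m) / (real k + 1))}"
  then have p: "p = (\<lambda>m. (k, real (j + m) / (real k + 1)))" by simp
  have "is_south_step (p (Suc m)) (p m)" for m
  proof -
    let ?N = "j + m"
    \<comment> \<open>Reduction modulo k + 1 supplies the label j \<le> k that a south step asks
      for, also where the ray crosses an integer height.\<close>
    have "p m = lhv (?N div Suc k) k (?N mod Suc k)"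
      by (simp only: p lhv_div_mod)
    moreover from this have "p (Suc m) = lhv (?N div Suc k) k (?N mod Suc k + 1)"
      by (simp add: p lhv_def field_simps)
    ultimately show ?thesis
      unfolding is_south_step_def
      by (intro exI[of _ "?N div Suc k"] exI[of _ k] exI[of _ "?N mod Suc k"])
        (simp add: less_Suc_eq_le[symmetric])
  qed
  moreover have "filterlim (\<lambda>m. snd (p m)) at_top sequentially"
  proof -
    have "filterlim (\<lambda>m. real (m + j)) at_top sequentially"
      by (rule filterlim_compose[OF filterlim_real_sequentially filterlim_add_const_nat_at_top])
    from filterlim_tendsto_pos_mult_at_top[OF tendsto_const[of "1 / (real k + 1)"] _ this]
    show ?thesis
      by (simp add: p add.commute)
  qed
  ultimately show "p \<in> paths_to k (lhv 0 k j)"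
    by (simp add: paths_to_def) (simp add: p lhv_def)
qed

lemma path_weight_column:
  assumes "\<And>m. fst (p m) = k"
  shows "path_weight w p = 1"
proof -
  have "east_steps p = {}"
    using assms by (auto simp: east_steps_def lhv_def) (metis fst_conv n_not_Suc_n)
  then show ?thesis by (simp add: path_weight_def)
qed

text \<open>With south steps only, the column would stay at \<open>fst v\<close> and not tend to
  k.\<close>

lemma exists_east_step:
  assumes p: "p \<in> paths_to k v" and "k < fst v"
  obtains t i j where "(t, i, j) \<in> east_steps p"
proof -
  have "\<exists>m. \<not> is_south_step (p (Suc m)) (p m)"
  proof (rule ccontr)
    assume "\<not> ?thesis"
    then have "fst (p (Suc m)) = fst (p m)" for m
      using is_south_step_coords by blast
    then have "fst (p m) = fst (p 0)" for m
      by (induction m) simp_all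
    moreover obtain M where "\<And>m. M \<le> m \<Longrightarrow> fst (p m) = k"
      using paths_to_eventually[OF p] by blast
    ultimately show False
      using assms by (metis (mono_tags, lifting) mem_Collect_eq nat_neq_iff order_refl paths_to_def)
  qed
  then obtain m where "is_east_step (p (m + 1)) (p m)"
    using p by (auto simp: paths_to_def)
  then show thesis
    using that unfolding is_east_step_def east_steps_def by blast
qed

text \<open>Heights do not decrease with the index, so the east step that the path must contain has
  t \<ge> 1 and weight zero.\<close>

lemma path_weight_above_eq_0:
  fixes w :: "nat \<Rightarrow> nat \<Rightarrow> nat \<Rightarrow> 'b::idom"
  assumes zero: "\<And>t i j. t \<ge> 1 \<Longrightarrow> j \<le> i \<Longrightarrow> w t i j = 0"
    and p: "p \<in> paths_to k v" and "k < fst v" "snd v \<ge> 1"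
  shows "path_weight w p = 0"
proof -
  obtain t i j where e: "(t, i, j) \<in> east_steps p"
    using exists_east_step[OF p \<open>k < fst v\<close>] by blast
  then obtain m where m: "j \<le> i" "p m = lhv t (i + 1) j"
    by (auto simp: east_steps_def)
  have "1 \<le> snd (p m)"
    using paths_to_snd_mono[OF p, of 0 m] p assms by (simp add: paths_to_def)
  \<comment> \<open>The step ends in column i + 1, hence the denominator i + 2; as j \<le> i, the
    fraction is below 1 and t = 0 is impossible.\<close>
  with m have "1 \<le> real t + real j / (real i + 2)"
    by (simp add: lhv_def add.commute)
  moreover have "real j / (real i + 2) < 1"
    using m(1) by simp
  ultimately have "t \<ge> 1"
    by (cases t) simp_all
  with m zero have "w t i j = 0" by simp
  with e show ?thesis
    using path_weight_nonzero_iff[OF p, of w] by force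
qed

section \<open>Weighted path sums and their recursion\<close>

abbreviation weighted_paths where
  "weighted_paths w k v \<equiv> {p \<in> paths_to k v. path_weight w p \<noteq> 0}"

text \<open>A sum over an infinite set defaults to 0, so finiteness is established together with the
  values.\<close>

definition weight_sum :: "(nat \<Rightarrow> nat \<Rightarrow> nat \<Rightarrow> 'b::comm_semiring_1) \<Rightarrow> nat \<Rightarrow> nat \<times> real \<Rightarrow> 'b" where
  "weight_sum w k v = (\<Sum>p\<in>weighted_paths w k v. path_weight w p)"

lemma weighted_paths_column:
  assumes "j \<le> k"
  shows "finite (weighted_paths w k (lhv 0 k j))"
    and "weight_sum w k (lhv 0 k j) = (1 :: 'b::idom)"
proof -
  define p where "p = (\<lambda>m. (k, real (j + m) / (real k + 1)))"
  have w: "path_weight w p = 1"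
    by (rule path_weight_column[of _ k]) (simp add: p_def)
  then have eq: "weighted_paths w k (lhv 0 k j) = {p}"
    unfolding paths_to_column[OF assms] p_def[symmetric] by auto
  show "finite (weighted_paths w k (lhv 0 k j))"
    unfolding eq by simp
  show "weight_sum w k (lhv 0 k j) = (1 :: 'b)"
    unfolding weight_sum_def eq by (simp add: w)
qed

text \<open>The boundary value F(n,n) = 0: the only predecessor lies at height 1, and from there on
  an east step is still required but has weight zero.\<close>

lemma weighted_paths_diagonal:
  fixes w :: "nat \<Rightarrow> nat \<Rightarrow> nat \<Rightarrow> 'b::idom"
  assumes zero: "\<And>t i j. t \<ge> 1 \<Longrightarrow> j \<le> i \<Longrightarrow> w t i j = 0" and "k < n"
  shows "weighted_paths w k (lhv 0 n n) = {}"
proof -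
  have "path_weight w p = 0" if "p \<in> paths_to k (lhv 0 n n)" for p
  proof -
    from that obtain u p' where u: "is_south_step u (lhv 0 n n) \<or> is_east_step u (lhv 0 n n)"
      and p': "p' \<in> paths_to k u" and p: "p = case_nat (lhv 0 n n) p'"
      unfolding paths_to_eq_step[of k "lhv 0 n n"] by blast
    \<comment> \<open>Since n > k, the column is \<open>Suc (n - 1)\<close>, and its vertex with j =
      n has no east predecessor.\<close>
    have "u = lhv 0 n (Suc n)"
      using u assms(2) is_south_step_lhv_iff[of n n u 0] is_east_step_lhv_iff[of n "n - 1" u 0]
      by auto
    then have u: "u = lhv 1 n 0" by (simp add: lhv_Suc_self)
    have "path_weight w p' = 0"
      using p' assms by (intro path_weight_above_eq_0[of w p' k u]) (auto simp: u lhv_def)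
    moreover have "p' 0 = u" using p' by (simp add: paths_to_def)
    ultimately show ?thesis
      unfolding p by (subst path_weight_south) (auto simp: u lhv_def)
  qed
  then show ?thesis by auto
qed

lemma inj_case_nat: "inj (case_nat v :: (nat \<Rightarrow> 'c) \<Rightarrow> nat \<Rightarrow> 'c)"
proof (rule injI)
  fix p p' :: "nat \<Rightarrow> 'c"
  assume "case_nat v p = case_nat v p'"
  then have "case_nat v p (Suc m) = case_nat v p' (Suc m)" for m by simp
  then show "p = p'" by auto
qed

text \<open>In an integral domain a nonzero \<open>w 0 n j\<close> preserves nonvanishing of
  weights, so splitting by the last step also splits the filtered sets.\<close>

lemma weighted_paths_step:
  fixes w :: "nat \<Rightarrow> nat \<Rightarrow> nat \<Rightarrow> 'b::idom"
  assumes "w 0 n j \<noteq> 0" "j \<le> n"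
    and fin: "finite (weighted_paths w k (lhv 0 (Suc n) (Suc j)))" "finite (weighted_paths w k (lhv 0 n j))"
  shows "finite (weighted_paths w k (lhv 0 (Suc n) j))"
    and "weight_sum w k (lhv 0 (Suc n) j)
      = weight_sum w k (lhv 0 (Suc n) (Suc j)) + w 0 n j * weight_sum w k (lhv 0 n j)"
proof -
  let ?v = "lhv 0 (Suc n) j" and ?s = "lhv 0 (Suc n) (Suc j)" and ?e = "lhv 0 n j"
  let ?c = "case_nat ?v"
  have s: "path_weight w (?c p) = path_weight w p" if "p \<in> paths_to k ?s" for p
    using that by (intro path_weight_south) (simp add: paths_to_def lhv_def)
  have e: "path_weight w (?c p) = w 0 n j * path_weight w p" if "p \<in> paths_to k ?e" for p
    using path_weight_east[OF that assms(2)] .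
  have "{u. is_south_step u ?v \<or> is_east_step u ?v} = {?s, ?e}"
    using assms(2) by (auto simp: is_south_step_lhv_iff is_east_step_lhv_iff)
  then have "paths_to k ?v = ?c ` paths_to k ?s \<union> ?c ` paths_to k ?e"
    using paths_to_eq_step[of k ?v] by simp
  then have eq: "weighted_paths w k ?v = ?c ` weighted_paths w k ?s \<union> ?c ` weighted_paths w k ?e"
    using s e assms(1) by auto
  then show "finite (weighted_paths w k ?v)"
    using fin by simp
  \<comment> \<open>The two kinds of extended paths differ at index 1, which lies in column n + 1 or
    in column n.\<close>
  have disj: "?c ` weighted_paths w k ?s \<inter> ?c ` weighted_paths w k ?e = {}"
  proof -
    have "p 0 \<noteq> p' 0" if "p \<in> paths_to k ?s" "p' \<in> paths_to k ?e" for p p'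
      using that by (simp add: paths_to_def lhv_def)
    then show ?thesis using injD[OF inj_case_nat] by fastforce
  qed
  have "weight_sum w k ?v = (\<Sum>p\<in>weighted_paths w k ?s. path_weight w (?c p))
      + (\<Sum>p\<in>weighted_paths w k ?e. path_weight w (?c p))"
    unfolding weight_sum_def eq using fin disj
    by (simp add: sum.union_disjoint sum.reindex[OF inj_on_subset[OF inj_case_nat subset_UNIV]])
  also have "\<dots> = weight_sum w k ?s + w 0 n j * weight_sum w k ?e"
    unfolding weight_sum_def sum_distrib_left using s e by (intro arg_cong2[of _ _ _ _ "(+)"] sum.cong) auto
  finally show "weight_sum w k ?v = weight_sum w k ?s + w 0 n j * weight_sum w k ?e" .
qed

section \<open>Evaluation of the path sums\<close>

text \<open>F(n,j) in closed form. Zero for j > k has to be explicit, because the truncated k - j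
  would turn the Gaussian binomial into 1.\<close>

definition sw_value :: "nat \<Rightarrow> nat \<Rightarrow> nat \<Rightarrow> 'a::field_char_0 poly fract" where
  "sw_value k n j = (if j \<le> k then q_inv ^ (Suc n choose 2) / q_inv ^ (Suc k choose 2)
     * q_inv ^ (j * (n - k)) * qbinom q_inv (n - j) (k - j) else 0)"

lemma sw_value_zero_right: "sw_value k n 0 = sw_moment n k"
  by (simp add: sw_value_def sw_moment_def)

lemma sw_value_column:
  assumes "j \<le> k"
  shows "sw_value k k j = 1"
  using assms by (simp add: sw_value_def power_inverse)

text \<open>This is \<open>qbinom_Suc_Suc'\<close> for [n+1-j, k-j]. From n to n + 1 the exponents
  C(n+1,2) and j(n-k) grow by n + 1 and j, which gives the weight of the east step.\<close>

lemma sw_value_step: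
  assumes "k \<le> n" "j \<le> n"
  shows "sw_value k (Suc n) j
    = sw_value k (Suc n) (Suc j) + q_inv ^ (Suc (n + j)) * (sw_value k n j :: 'a::field_char_0 poly fract)"
proof -
  let ?u = "q_inv :: 'a poly fract"
  have "Suc (Suc n) choose 2 = Suc n + (Suc n choose 2)"
    by (simp add: numeral_2_eq_2)
  then have C: "?u ^ (Suc (Suc n) choose 2) = ?u ^ Suc n * ?u ^ (Suc n choose 2)"
    by (simp only: power_add)
  have D: "?u ^ (j * (Suc n - k)) = ?u ^ j * ?u ^ (j * (n - k))"
    using assms by (simp add: Suc_diff_le power_add)
  show ?thesis
  proof (cases "j < k")
    case True
    then have "qbinom ?u (Suc n - j) (k - j)
        = qbinom ?u (Suc n - Suc j) (k - j) + ?u ^ (Suc n - k) * qbinom ?u (Suc n - Suc j) (k - Suc j)"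
      using qbinom_Suc_Suc'[OF q_inv_not_root, of "k - Suc j" "n - j"] assms
        diff_le_mono2[of j "Suc j" n] diff_le_mono[of k n "Suc j"]
      by (simp add: Suc_diff_le Suc_diff_Suc del: qbinom.simps)
    moreover have "?u ^ (Suc j * (Suc n - k)) = ?u ^ (Suc n - k) * (?u ^ j * ?u ^ (j * (n - k)))"
      by (simp add: power_add D)
    ultimately show ?thesis
      using True unfolding sw_value_def C D
      by (simp add: power_add distrib_left add_divide_distrib mult_ac del: qbinom.simps power_inverse)
  next
    \<comment> \<open>For j = k the first summand is zero and the binomials are 1, so only the
      prefactors have to match; for j > k everything is zero.\<close>
    case False
    then show ?thesis
      unfolding sw_value_def C D by (simp add: power_add)
  qed
qed

text \<open>The value at (n+1,j) depends on (n+1,j+1) and (n,j). So the outer induction runs over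
  the columns from k upwards, the inner one down each column from its vertex j = n + 1.\<close>

lemma weight_sum_eq_sw_value:
  fixes w :: "nat \<Rightarrow> nat \<Rightarrow> nat \<Rightarrow> 'a::field_char_0 poly fract"
  assumes w0: "\<And>i j. j \<le> i \<Longrightarrow> w 0 i j = q_inv ^ (Suc (i + j))"
    and zero: "\<And>t i j. t \<ge> 1 \<Longrightarrow> j \<le> i \<Longrightarrow> w t i j = 0"
    and "k \<le> n" "j \<le> n"
  shows "finite (weighted_paths w k (lhv 0 n j)) \<and> weight_sum w k (lhv 0 n j) = sw_value k n j"
  using \<open>k \<le> n\<close> \<open>j \<le> n\<close>
proof (induction n arbitrary: j rule: dec_induct)
  case base
  then show ?case by (simp add: weighted_paths_column sw_value_column)
next
  case (step n)
  note IH = step.IH and kn = step.hyps(1)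
  show ?case
    using \<open>j \<le> Suc n\<close>
  proof (induction j rule: inc_induct)
    case base
    have "weighted_paths w k (lhv 0 (Suc n) (Suc n)) = {}"
      using step.hyps by (intro weighted_paths_diagonal zero) simp_all
    then show ?case
      using step.hyps unfolding weight_sum_def by (simp only: finite.emptyI sum.empty sw_value_def) simp
  next
    case (step j)
    then have "j \<le> n" by simp
    then have "w 0 n j \<noteq> 0" by (simp add: w0)
    note s = weighted_paths_step[of w n j k, OF this \<open>j \<le> n\<close>]
    show ?case
      using s step.IH IH[OF \<open>j \<le> n\<close>]
      by (simp add: w0 \<open>j \<le> n\<close> sw_value_step[OF kn \<open>j \<le> n\<close>])
  qed
qed

theorem proposition4p3:
  fixes w :: "nat \<Rightarrow> nat \<Rightarrow> nat \<Rightarrow> 'a::field_char_0 poly fract" and n k :: nat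
  assumes "has_height w 1"
    and "\<And>i j. j \<le> i \<Longrightarrow> w 0 i j = q_var powi (- int i - int j - 1)"
    and "\<And>t i j. t \<ge> 1 \<Longrightarrow> j \<le> i \<Longrightarrow> w t i j = 0"
    and "k \<le> n"
  shows "h_sum w n k = sw_mixed_moment n k"
proof -
  have "w 0 i j = q_inv ^ Suc (i + j)" if "j \<le> i" for i j
  proof -
    have "- int i - int j - 1 = - int (Suc (i + j))" by simp
    then show ?thesis
      unfolding assms(2)[OF that] by (simp only: power_int_minus power_int_of_nat power_inverse)
  qed
  then have "weight_sum w k (lhv 0 n 0) = sw_value k n 0"
    using weight_sum_eq_sw_value[of w k n 0] assms(3,4) by blast
  then show ?thesis
    by (simp add: h_sum_def SE_paths_eq weight_sum_def sw_value_zero_right sw_mixed_moment_eq)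
qed

end
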